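(* Assume $m_3$ is strictly convex on $\mathbb R^n$. Let $\tau\in(\frac13,\frac12)$ and, for each $i\ge0$, let $$M_{\alpha^+}(s^{(i)},s)=f_i+g_i^Ts+\tfrac12\Big(1+\tfrac{1}{3\tau}\Big)s^TH_is+(1+2\tau)\tfrac{\sigma}{4}\|s\|^4 .$$ Starting from $s^{(0)}=0$, let the iterates be updated by $s_+^{(i)}=\operatorname{argmin}_{s\in\mathbb R^n}M_{\alpha^+}(s^{(i)},s)$ and $s^{(i+1)}=s^{(i)}+s_+^{(i)}$. Let $m_*=\min_{s\in\mathbb R^n}m_3(s)$ and let $\mu$ satisfy $$0<\mu\le\min\Big\{\tfrac{3\tau-1}{3\tau+1},\ \Big[\tfrac{1-2\tau}{1+2\tau}\Big]^{1/3}\Big\}.$$ Then for all $i\ge0$, $$m_3(s^{(i)})-m_*\le(1-\mu)^i\,\big(m_3(s^{(0)})-m_*\big).$$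
   Context: Let $f_0\in\mathbb R$, $g\in\mathbb R^n$, $H\in\mathbb R^{n\times n}$ symmetric, $T\in\mathbb R^{n\times n\times n}$ a symmetric third-order tensor, $\sigma>0$, $\|\cdot\|$ the Euclidean norm, and $m_3(s)=f_0+g^Ts+\frac12s^THs+\frac16T[s]^3+\frac{\sigma}{4}\|s\|^4$ for $s\in\mathbb R^n$. For an iterate $s^{(i)}$, $f_i=m_3(s^{(i)})$, $g_i=\nabla m_3(s^{(i)})$, $H_i=\nabla^2m_3(s^{(i)})$. *)

theory Defs
  imports "HOL-Analysis.Analysis"
begin

definition strictly_convex_on :: "'a::real_vector set \<Rightarrow> ('a \<Rightarrow> real) \<Rightarrow> bool" where
  "strictly_convex_on S f \<longleftrightarrow> convex S \<and>
     (\<forall>x\<in>S. \<forall>y\<in>S. \<forall>u. x \<noteq> y \<longrightarrow> 0 < u \<longrightarrow> u < 1 \<longrightarrow>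
        f ((1 - u) *\<^sub>R x + u *\<^sub>R y) < (1 - u) * f x + u * f y)"

definition symmetric_tensor3 :: "real ^ 'n ^ 'n ^ 'n \<Rightarrow> bool" where
  "symmetric_tensor3 T \<longleftrightarrow>
     (\<forall>i j k. T $ i $ j $ k = T $ j $ i $ k \<and> T $ i $ j $ k = T $ i $ k $ j)"
  (* the two transpositions generate all permutations of the three indices *)

definition tensor3_cube :: "real ^ 'n ^ 'n ^ 'n \<Rightarrow> real ^ 'n \<Rightarrow> real" where
  "tensor3_cube T s =
     (\<Sum>i\<in>UNIV. \<Sum>j\<in>UNIV. \<Sum>k\<in>UNIV. T $ i $ j $ k * s $ i * s $ j * s $ k)"

definition gradient :: "(real ^ 'n \<Rightarrow> real) \<Rightarrow> real ^ 'n \<Rightarrow> real ^ 'n" where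
  "gradient f x = (THE D. GDERIV f x :> D)"

definition hessian :: "(real ^ 'n \<Rightarrow> real) \<Rightarrow> real ^ 'n \<Rightarrow> real ^ 'n ^ 'n" where
  "hessian f x = jacobian (gradient f) (at x)"

definition m3 :: "real \<Rightarrow> real ^ 'n \<Rightarrow> real ^ 'n ^ 'n \<Rightarrow> real ^ 'n ^ 'n ^ 'n \<Rightarrow> real
    \<Rightarrow> real ^ 'n \<Rightarrow> real" where
  "m3 f0 g H T \<sigma> s =
     f0 + g \<bullet> s + 1/2 * (s \<bullet> (H *v s)) + 1/6 * tensor3_cube T s + \<sigma>/4 * norm s ^ 4"

(* M_{alpha+}(x, s) for a model m; the derivatives of m are taken at the base point x,
   and s is the step *)
definition M_alpha_plus :: "(real ^ 'n \<Rightarrow> real) \<Rightarrow> real \<Rightarrow> real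
    \<Rightarrow> real ^ 'n \<Rightarrow> real ^ 'n \<Rightarrow> real" where
  "M_alpha_plus m \<sigma> \<tau> x s =
     m x + gradient m x \<bullet> s + 1/2 * (1 + 1 / (3 * \<tau>)) * (s \<bullet> (hessian m x *v s))
       + (1 + 2 * \<tau>) * (\<sigma>/4) * norm s ^ 4"

end

theory Submission
  imports Defs
begin

text \<open>
  Along a line through \<open>x\<close> with direction \<open>d\<close> the model is a quartic polynomial
  \<open>f + p t + a/2 t\<^sup>2 + b/6 t\<^sup>3 + c/4 t\<^sup>4\<close>, and convexity of the model says that
  \<open>a + b t + 3 c t\<^sup>2 \<ge> 0\<close> for all \<open>t\<close>. Evaluating this at \<open>t = \<plusminus>\<tau>\<close> bounds the cubic
  term by \<open>\<bar>b\<bar>/6 \<le> a/(6\<tau>) + \<tau> c/2\<close>, so \<open>m3 (x + d)\<close> lies between \<open>M_alpha_plus\<close> and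
  the analogous model in which \<open>\<tau>\<close> is replaced by \<open>-\<tau>\<close>. For \<open>d\<close> leading from \<open>x\<close> to the
  minimiser of \<open>m3\<close>, the upper model at the shortened step \<open>\<mu> d\<close> is at most the
  interpolation \<open>(1 - \<mu>) m3 x + \<mu> L\<close> with \<open>L\<close> the lower model at \<open>d\<close>; the two bounds on
  \<open>\<mu>\<close> compare the quadratic and the quartic coefficients.
\<close>

section \<open>Contraction of the third-order tensor\<close>

text \<open>Leaving the third index free gives a bounded bilinear map, so the library's product rule
  applies to the cubic term and to its gradient.\<close>

definition tensor3_contract :: "real ^ 'n ^ 'n ^ 'n \<Rightarrow> real ^ 'n \<Rightarrow> real ^ 'n \<Rightarrow> real ^ 'n" where
  "tensor3_contract T u v = (\<chi> k. \<Sum>i\<in>UNIV. \<Sum>j\<in>UNIV. T $ i $ j $ k * u $ i * v $ j)"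

lemma bilinear_tensor3_contract: "bilinear (tensor3_contract T)"
  unfolding bilinear_def
  by (intro conjI allI linearI)
     (simp_all add: tensor3_contract_def vec_eq_iff algebra_simps sum.distrib sum_distrib_left)

lemma bounded_bilinear_tensor3_contract: "bounded_bilinear (tensor3_contract T)"
  using bilinear_tensor3_contract bilinear_conv_bounded_bilinear by blast

lemma tensor3_contract_inner:
  "tensor3_contract T u v \<bullet> w =
     (\<Sum>i\<in>UNIV. \<Sum>j\<in>UNIV. \<Sum>k\<in>UNIV. T $ i $ j $ k * u $ i * v $ j * w $ k)"
proof -
  have "tensor3_contract T u v \<bullet> w =
      (\<Sum>k\<in>UNIV. \<Sum>i\<in>UNIV. \<Sum>j\<in>UNIV. T $ i $ j $ k * u $ i * v $ j * w $ k)"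
    by (simp add: tensor3_contract_def inner_vec_def sum_distrib_right)
  also have "\<dots> = (\<Sum>i\<in>UNIV. \<Sum>k\<in>UNIV. \<Sum>j\<in>UNIV. T $ i $ j $ k * u $ i * v $ j * w $ k)"
    by (rule sum.swap)
  also have "\<dots> = (\<Sum>i\<in>UNIV. \<Sum>j\<in>UNIV. \<Sum>k\<in>UNIV. T $ i $ j $ k * u $ i * v $ j * w $ k)"
    by (rule sum.cong[OF refl], rule sum.swap)
  finally show ?thesis .
qed

lemma tensor3_cube_eq: "tensor3_cube T s = tensor3_contract T s s \<bullet> s"
  by (simp add: tensor3_cube_def tensor3_contract_inner)

lemma tensor3_contract_commute:
  assumes "symmetric_tensor3 T"
  shows "tensor3_contract T u v = tensor3_contract T v u"
proof -
  have "(\<Sum>i\<in>UNIV. \<Sum>j\<in>UNIV. T $ i $ j $ k * u $ i * v $ j) =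
        (\<Sum>i\<in>UNIV. \<Sum>j\<in>UNIV. T $ i $ j $ k * v $ i * u $ j)" for k
  proof -
    have "T $ i $ j $ k = T $ j $ i $ k" for i j
      using assms unfolding symmetric_tensor3_def by blast
    then have "(\<Sum>i\<in>UNIV. \<Sum>j\<in>UNIV. T $ i $ j $ k * u $ i * v $ j) =
        (\<Sum>i\<in>UNIV. \<Sum>j\<in>UNIV. T $ j $ i $ k * v $ j * u $ i)"
      by (intro sum.cong refl) (simp add: mult.commute mult.left_commute)
    also have "\<dots> = (\<Sum>i\<in>UNIV. \<Sum>j\<in>UNIV. T $ i $ j $ k * v $ i * u $ j)"
      by (rule sum.swap)
    finally show ?thesis .
  qed
  then show ?thesis
    by (simp add: tensor3_contract_def vec_eq_iff)
qed

lemma tensor3_contract_inner_commute: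
  assumes "symmetric_tensor3 T"
  shows "tensor3_contract T u v \<bullet> w = tensor3_contract T u w \<bullet> v"
proof -
  have "T $ i $ j $ k = T $ i $ k $ j" for i j k
    using assms unfolding symmetric_tensor3_def by blast
  then have "(\<Sum>j\<in>UNIV. \<Sum>k\<in>UNIV. T $ i $ j $ k * u $ i * v $ j * w $ k) =
      (\<Sum>j\<in>UNIV. \<Sum>k\<in>UNIV. T $ i $ k $ j * u $ i * w $ k * v $ j)" for i
    by (intro sum.cong refl) (simp add: mult.commute mult.left_commute)
  also have "\<dots> i = (\<Sum>j\<in>UNIV. \<Sum>k\<in>UNIV. T $ i $ j $ k * u $ i * w $ j * v $ k)" for i
    by (rule sum.swap)
  finally show ?thesis
    by (simp add: tensor3_contract_inner)
qed

section \<open>Gradient and Hessian of the model\<close>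

lemma inner_matrix_commute:
  fixes H :: "real ^ 'n ^ 'n"
  assumes "transpose H = H"
  shows "u \<bullet> (H *v v) = v \<bullet> (H *v u)"
  by (metis assms dot_lmul_matrix inner_commute transpose_matrix_vector)

lemma norm_power4: "norm x ^ 4 = (x \<bullet> x)\<^sup>2"
  for x :: "'a::real_inner"
  by (simp add: power2_norm_eq_inner[symmetric])

definition m3_grad :: "real ^ 'n \<Rightarrow> real ^ 'n ^ 'n \<Rightarrow> real ^ 'n ^ 'n ^ 'n \<Rightarrow> real
    \<Rightarrow> real ^ 'n \<Rightarrow> real ^ 'n" where
  "m3_grad g H T \<sigma> x = g + H *v x + (1/2) *\<^sub>R tensor3_contract T x x + (\<sigma> * (x \<bullet> x)) *\<^sub>R x"

text \<open>Kept as a linear map in \<open>h\<close>, the form in which a Frechet derivative arises;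
  symmetry of \<open>T\<close> is what merges the two product-rule terms into one
  contraction.\<close>

definition m3_hess :: "real ^ 'n ^ 'n \<Rightarrow> real ^ 'n ^ 'n ^ 'n \<Rightarrow> real
    \<Rightarrow> real ^ 'n \<Rightarrow> real ^ 'n \<Rightarrow> real ^ 'n" where
  "m3_hess H T \<sigma> x h = H *v h + tensor3_contract T x h
     + (2 * \<sigma> * (x \<bullet> h)) *\<^sub>R x + (\<sigma> * (x \<bullet> x)) *\<^sub>R h"

text \<open>Inner products replace the norm, so no differentiability issue arises at the
  origin.\<close>

lemma m3_altdef:
  "m3 f0 g H T \<sigma> = (\<lambda>s. f0 + g \<bullet> s + 1/2 * (s \<bullet> (H *v s))
     + 1/6 * (tensor3_contract T s s \<bullet> s) + \<sigma>/4 * (s \<bullet> s)\<^sup>2)"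
  by (rule ext) (simp add: m3_def tensor3_cube_eq norm_power4)

text \<open>The product rule gives one term per slot. Symmetry identifies the two copies for
  \<open>H\<close> and the three for \<open>T\<close>, turning the factors 1/2 and 1/6 into 1 and
  1/2.\<close>

lemma gderiv_m3:
  assumes "transpose H = H" "symmetric_tensor3 T"
  shows "GDERIV (m3 f0 g H T \<sigma>) x :> m3_grad g H T \<sigma> x"
proof -
  note [derivative_intros] =
    bounded_bilinear.FDERIV[OF bounded_bilinear_tensor3_contract]
    bounded_linear.has_derivative[OF matrix_vector_mul_bounded_linear]
  have "tensor3_contract T x h \<bullet> x = tensor3_contract T x x \<bullet> h"
    "tensor3_contract T h x \<bullet> x = tensor3_contract T x x \<bullet> h" for h
    using tensor3_contract_commute[OF assms(2)] tensor3_contract_inner_commute[OF assms(2)]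
    by metis+
  moreover have "x \<bullet> (H *v h) = (H *v x) \<bullet> h" for h
    using inner_matrix_commute[OF assms(1), of x h] by (simp add: inner_commute)
  ultimately show ?thesis
    unfolding gderiv_def m3_altdef m3_grad_def
    by - (rule has_derivative_eq_rhs, (rule derivative_intros)+, rule ext,
        simp add: inner_simps, simp add: inner_commute)
qed

lemma gradient_m3:
  assumes "transpose H = H" "symmetric_tensor3 T"
  shows "gradient (m3 f0 g H T \<sigma>) = m3_grad g H T \<sigma>"
proof
  fix x
  show "gradient (m3 f0 g H T \<sigma>) x = m3_grad g H T \<sigma> x"
    unfolding gradient_def
  proof (rule the_equality)
    show "GDERIV (m3 f0 g H T \<sigma>) x :> m3_grad g H T \<sigma> x"
      by (rule gderiv_m3[OF assms])
    show "D = m3_grad g H T \<sigma> x" if "GDERIV (m3 f0 g H T \<sigma>) x :> D" for D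
    proof -
      have "(\<lambda>h. h \<bullet> D) = (\<lambda>h. h \<bullet> m3_grad g H T \<sigma> x)"
        using that gderiv_m3[OF assms] unfolding gderiv_def by (rule has_derivative_unique)
      then show ?thesis by (metis vector_eq_ldot)
    qed
  qed
qed

lemma m3_grad_has_derivative:
  assumes "symmetric_tensor3 T"
  shows "(m3_grad g H T \<sigma> has_derivative m3_hess H T \<sigma> x) (at x)"
proof -
  note [derivative_intros] =
    bounded_bilinear.FDERIV[OF bounded_bilinear_tensor3_contract]
    bounded_linear.has_derivative[OF matrix_vector_mul_bounded_linear]
  have "m3_grad g H T \<sigma> = (\<lambda>x. g + H *v x + (1/2) *\<^sub>R tensor3_contract T x x
      + (\<sigma> * (x \<bullet> x)) *\<^sub>R x)"
    by (simp add: m3_grad_def fun_eq_iff)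
  moreover have "(\<dots> has_derivative m3_hess H T \<sigma> x) (at x)"
    by (auto intro!: derivative_eq_intros
        simp: fun_eq_iff m3_hess_def tensor3_contract_commute[OF assms, of _ x] inner_commute
          algebra_simps scaleR_2 simp flip: scaleR_add_left)
  ultimately show ?thesis by simp
qed

lemma hessian_m3_mult:
  assumes "transpose H = H" "symmetric_tensor3 T"
  shows "hessian (m3 f0 g H T \<sigma>) x *v h = m3_hess H T \<sigma> x h"
proof -
  note D = m3_grad_has_derivative[OF assms(2), of g H \<sigma> x]
  have "hessian (m3 f0 g H T \<sigma>) x = matrix (m3_hess H T \<sigma> x)"
    by (simp add: hessian_def gradient_m3[OF assms] jacobian_def frechet_derivative_at[OF D])
  then show ?thesis
    using has_derivative_linear[OF D] by (simp add: matrix_works)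
qed

section \<open>Expansion along lines and convexity\<close>

text \<open>The Taylor expansion is exact because the model is a quartic polynomial. The term with
  \<open>x \<bullet> d\<close> is the share of the regularisation in the third directional
  derivative.\<close>

lemma m3_expansion:
  assumes "transpose H = H" "symmetric_tensor3 T" and m: "m = m3 f0 g H T \<sigma>"
  shows "m (x + t *\<^sub>R d) = m x + (gradient m x \<bullet> d) * t
     + (d \<bullet> (hessian m x *v d)) / 2 * t\<^sup>2
     + (tensor3_cube T d + 6 * \<sigma> * (x \<bullet> d) * (d \<bullet> d)) / 6 * t ^ 3
     + \<sigma> * norm d ^ 4 / 4 * t ^ 4"
proof -
  interpret T: bounded_bilinear "tensor3_contract T"
    by (rule bounded_bilinear_tensor3_contract)
  note T_sym = tensor3_contract_commute[OF assms(2)] tensor3_contract_inner_commute[OF assms(2)]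
  have Tdx: "tensor3_contract T d x = tensor3_contract T x d"
    and Txdx: "tensor3_contract T x d \<bullet> x = tensor3_contract T x x \<bullet> d"
    and Tddx: "tensor3_contract T d d \<bullet> x = tensor3_contract T x d \<bullet> d"
    using T_sym by metis+
  have Hdx: "d \<bullet> (H *v x) = x \<bullet> (H *v d)"
    by (rule inner_matrix_commute[OF assms(1)])
  let ?y = "x + t *\<^sub>R d"
  have "?y \<bullet> (H *v ?y) = x \<bullet> (H *v x) + 2 * t * (x \<bullet> (H *v d)) + t\<^sup>2 * (d \<bullet> (H *v d))"
    by (simp add: matrix_vector_right_distrib matrix_vector_mult_scaleR inner_simps Hdx
        power2_eq_square algebra_simps)
  moreover have "tensor3_contract T ?y ?y \<bullet> ?y = tensor3_contract T x x \<bullet> x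
      + 3 * t * (tensor3_contract T x x \<bullet> d) + 3 * t\<^sup>2 * (tensor3_contract T x d \<bullet> d)
      + t ^ 3 * (tensor3_contract T d d \<bullet> d)"
    by (simp add: T.add_left T.add_right T.scaleR_left T.scaleR_right inner_simps Tdx Txdx Tddx
          del: mult_2 one_add_one)
       (simp add: power2_eq_square power3_eq_cube algebra_simps)
  moreover have "?y \<bullet> ?y = x \<bullet> x + 2 * t * (x \<bullet> d) + t\<^sup>2 * (d \<bullet> d)"
    by (simp add: inner_simps inner_commute[of d x] power2_eq_square algebra_simps)
  moreover have "g \<bullet> ?y = g \<bullet> x + t * (g \<bullet> d)"
    by (simp add: inner_simps)
  moreover have "m3_grad g H T \<sigma> x \<bullet> d = g \<bullet> d + x \<bullet> (H *v d)
      + (tensor3_contract T x x \<bullet> d) / 2 + \<sigma> * (x \<bullet> x) * (x \<bullet> d)"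
    using Hdx by (simp add: m3_grad_def inner_simps inner_commute[of "H *v x" d])
  moreover have "d \<bullet> m3_hess H T \<sigma> x d = d \<bullet> (H *v d) + tensor3_contract T x d \<bullet> d
      + 2 * \<sigma> * (x \<bullet> d)\<^sup>2 + \<sigma> * (x \<bullet> x) * (d \<bullet> d)"
    by (simp add: m3_hess_def inner_simps inner_commute[of d "tensor3_contract T x d"]
        inner_commute[of d x] power2_eq_square)
  ultimately show ?thesis
    unfolding m gradient_m3[OF assms(1,2)] hessian_m3_mult[OF assms(1,2)] tensor3_cube_eq norm_power4
    unfolding m3_altdef
    by (simp only:) (simp add: power2_eq_square power3_eq_cube power4_eq_xxxx algebra_simps
        add_divide_distrib)
qed

lemma strictly_convex_on_midpoint:
  assumes "strictly_convex_on UNIV f"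
  shows "2 * f x \<le> f (x + y) + f (x - y)"
\<comment> \<open>Strict convexity speaks of distinct points only; for \<open>y = 0\<close> both
  sides coincide.\<close>
proof (cases "y = 0")
  case False
  then have ne: "x + y \<noteq> x - y"
    by (simp add: eq_neg_iff_add_eq_0 flip: scaleR_2)
  have "(1 - 1/2) *\<^sub>R (x + y) + (1/2) *\<^sub>R (x - y) = x"
    by (simp add: algebra_simps flip: scaleR_add_left)
  moreover have "f ((1 - 1/2) *\<^sub>R (x + y) + (1/2) *\<^sub>R (x - y)) < (1 - 1/2) * f (x + y) + 1/2 * f (x - y)"
    using assms unfolding strictly_convex_on_def
    by (elim conjE, elim ballE[of _ _ "x + y"] ballE[of _ _ "x - y"] allE[of _ "1/2"])
       (use ne in simp_all)
  ultimately show ?thesis by simp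
qed simp

text \<open>The second difference of a quartic with step \<open>h\<close> is exactly
  \<open>h\<^sup>2\<close> times the second derivative plus \<open>c / 2 * h\<^sup>2\<close>. An
  explicit small \<open>h\<close> then replaces the limit.\<close>

lemma quartic_second_derivative_nonneg:
  fixes a b c f p t :: real
  defines "\<phi> \<equiv> \<lambda>t. f + p * t + a / 2 * t\<^sup>2 + b / 6 * t ^ 3 + c / 4 * t ^ 4"
  assumes mid: "\<And>t h. 2 * \<phi> t \<le> \<phi> (t + h) + \<phi> (t - h)" and "c \<ge> 0"
  shows "0 \<le> a + b * t + 3 * c * t\<^sup>2"
proof -
  define q where "q = a + b * t + 3 * c * t\<^sup>2"
  have "\<phi> (t + h) + \<phi> (t - h) - 2 * \<phi> t = h\<^sup>2 * (q + c / 2 * h\<^sup>2)" for h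
    unfolding \<phi>_def q_def by (simp add: field_simps) algebra
  then have pos: "0 \<le> h\<^sup>2 * (q + c / 2 * h\<^sup>2)" for h
    using mid[of t h] by (metis diff_ge_0_iff_ge)
  have "0 \<le> q"
  proof (rule ccontr)
    assume "\<not> 0 \<le> q"
    show False
    proof (cases "c = 0")
      case True
      then show False using pos[of 1] \<open>\<not> 0 \<le> q\<close> by simp
    next
      case False
      \<comment> \<open>With this \<open>h\<close> the correction is \<open>- q / 2\<close>, so the
        bracket equals \<open>q / 2\<close>, still negative.\<close>
      define h where "h = sqrt (- q / c)"
      have "h\<^sup>2 = - q / c" "- q / c > 0"
        using \<open>\<not> 0 \<le> q\<close> \<open>c \<ge> 0\<close> False by (auto simp: h_def divide_simps)
      with pos[of h] have "0 \<le> q + c / 2 * (- q / c)"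
        by (metis zero_le_mult_iff not_less)
      then show False using False \<open>\<not> 0 \<le> q\<close> by simp
    qed
  qed
  then show ?thesis by (simp add: q_def)
qed

section \<open>Existence of minimisers\<close>

text \<open>The quartic term dominates outside a ball, where the model is at least
  \<open>f0\<close>, its value at 0; a minimiser over the compact ball is therefore global.
  Arbitrary \<open>H\<close> and \<open>T\<close> let this serve the auxiliary model too.\<close>

lemma m3_attains_min:
  fixes g :: "real ^ 'n"
  assumes "\<sigma> > 0"
  obtains x where "\<And>y. m3 f0 g H T \<sigma> x \<le> m3 f0 g H T \<sigma> y"
proof -
  interpret T: bounded_bilinear "tensor3_contract T"
    by (rule bounded_bilinear_tensor3_contract)
  obtain K2 where K2: "K2 > 0" "\<And>s. norm (H *v s) \<le> norm s * K2"
    using bounded_linear.pos_bounded[OF matrix_vector_mul_bounded_linear[of H]] by auto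
  obtain K3 where K3: "K3 > 0" "\<And>s. norm (tensor3_contract T s s) \<le> norm s * norm s * K3"
    using T.pos_bounded by auto
  \<comment> \<open>The summand 1 gives \<open>r \<ge> 1\<close>, so lower powers of
    \<open>r\<close> are at most \<open>r ^ 3\<close>; the rest lets the quartic term absorb all
    three bounds.\<close>
  define R where "R = 1 + 4 / \<sigma> * (norm g + K2 + K3)"
  have far: "f0 \<le> m3 f0 g H T \<sigma> s" if "norm s > R" for s
  proof -
    define r where "r = norm s"
    have "R \<ge> 1" using assms K2(1) K3(1) by (simp add: R_def)
    then have r1: "r \<ge> 1" using that by (simp add: r_def)
    have "4 / \<sigma> * (norm g + K2 + K3) \<le> r"
      using that by (simp add: R_def r_def)
    then have "norm g + K2 + K3 \<le> \<sigma> / 4 * r"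
      using assms by (simp add: field_simps)
    then have "(norm g + K2 + K3) * r ^ 3 \<le> \<sigma> / 4 * r * r ^ 3"
      using r1 by (intro mult_right_mono) auto
    moreover have "norm g * r \<le> norm g * r ^ 3"
      using r1 power_increasing[of 1 3 r] by (intro mult_left_mono) auto
    moreover have "K2 * r\<^sup>2 \<le> K2 * r ^ 3"
      using r1 K2(1) power_increasing[of 2 3 r] by (intro mult_left_mono) auto
    \<comment> \<open>These signs allow the factors 1/2 and 1/6 to be replaced by 1.\<close>
    moreover have "0 \<le> K2 * r\<^sup>2" "0 \<le> K3 * r ^ 3"
      using r1 K2(1) K3(1) by auto
    moreover have "\<bar>g \<bullet> s\<bar> \<le> norm g * r"
      unfolding r_def by (rule Cauchy_Schwarz_ineq2)
    moreover have "\<bar>s \<bullet> (H *v s)\<bar> \<le> K2 * r\<^sup>2"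
    proof -
      have "\<bar>s \<bullet> (H *v s)\<bar> \<le> norm s * norm (H *v s)" by (rule Cauchy_Schwarz_ineq2)
      also have "\<dots> \<le> norm s * (norm s * K2)" using K2(2) by (intro mult_left_mono) auto
      finally show ?thesis by (simp add: r_def power2_eq_square mult_ac)
    qed
    moreover have "\<bar>tensor3_contract T s s \<bullet> s\<bar> \<le> K3 * r ^ 3"
    proof -
      have "\<bar>tensor3_contract T s s \<bullet> s\<bar> \<le> norm (tensor3_contract T s s) * norm s"
        by (rule Cauchy_Schwarz_ineq2)
      also have "\<dots> \<le> norm s * norm s * K3 * norm s" using K3(2) by (intro mult_right_mono) auto
      finally show ?thesis by (simp add: r_def power3_eq_cube mult_ac)
    qed
    ultimately show ?thesis
      unfolding m3_def tensor3_cube_eq r_def[symmetric]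
      by (simp add: algebra_simps power4_eq_xxxx power3_eq_cube)
  qed
  have "R \<ge> 0" using assms K2(1) K3(1) by (simp add: R_def)
  have "continuous_on (cball 0 R) (m3 f0 g H T \<sigma>)"
    unfolding m3_altdef by (intro continuous_intros T.continuous_on)
  then obtain x where x: "\<And>y. y \<in> cball 0 R \<Longrightarrow> m3 f0 g H T \<sigma> x \<le> m3 f0 g H T \<sigma> y"
    using continuous_attains_inf[of "cball 0 R" "m3 f0 g H T \<sigma>"] \<open>R \<ge> 0\<close>
    by (metis cball_eq_empty compact_cball not_less)
  have "m3 f0 g H T \<sigma> x \<le> m3 f0 g H T \<sigma> y" for y
  proof (cases "norm y > R")
    case True
    have "m3 f0 g H T \<sigma> x \<le> m3 f0 g H T \<sigma> 0" using x \<open>R \<ge> 0\<close> by simp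
    also have "\<dots> = f0" by (simp add: m3_altdef)
    finally show ?thesis using far[OF True] by linarith
  qed (simp add: x)
  then show thesis by (rule that)
qed

text \<open>The auxiliary model is itself of the form \<open>m3\<close>, with zero tensor, so
  existence of its minimisers is inherited.\<close>

lemma M_alpha_plus_eq_m3:
  "M_alpha_plus m \<sigma> \<tau> x =
     m3 (m x) (gradient m x) ((1 + 1 / (3 * \<tau>)) *\<^sub>R hessian m x) 0 ((1 + 2 * \<tau>) * \<sigma>)"
  by (simp add: fun_eq_iff M_alpha_plus_def m3_def tensor3_cube_def flip: scaleR_matrix_vector_assoc)

text \<open>\<open>ARG_MIN\<close> is a choice operator, so an existing minimiser must be supplied
  before the chosen point is known to minimise.\<close>

lemma M_alpha_plus_arg_min:
  assumes "\<sigma> > 0" "\<tau> > 0"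
  shows "M_alpha_plus m \<sigma> \<tau> x (ARG_MIN (M_alpha_plus m \<sigma> \<tau> x) d. True) \<le> M_alpha_plus m \<sigma> \<tau> x d"
proof -
  have "(1 + 2 * \<tau>) * \<sigma> > 0" using assms by simp
  then obtain z where "\<And>y. M_alpha_plus m \<sigma> \<tau> x z \<le> M_alpha_plus m \<sigma> \<tau> x y"
    unfolding M_alpha_plus_eq_m3 using m3_attains_min by blast
  then have "is_arg_min (M_alpha_plus m \<sigma> \<tau> x) (\<lambda>d. True) z"
    by (simp add: is_arg_min_linorder)
  then have "is_arg_min (M_alpha_plus m \<sigma> \<tau> x) (\<lambda>d. True) (ARG_MIN (M_alpha_plus m \<sigma> \<tau> x) d. True)"
    unfolding arg_min_def by (rule someI)
  then show ?thesis by (simp add: is_arg_min_linorder)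
qed

section \<open>Upper and lower auxiliary models\<close>

text \<open>Negating \<open>\<tau>\<close> flips the sign of both corrections
  \<open>a / (6 * \<tau>)\<close> and \<open>\<tau> * c / 2\<close>, so one formula yields both
  models.\<close>

lemma convex_m3_model_bounds:
  assumes sym: "transpose H = H" "symmetric_tensor3 T" and m: "m = m3 f0 g H T \<sigma>"
    and "\<sigma> > 0" "\<tau> > 0" and conv: "strictly_convex_on UNIV m"
  shows "0 \<le> d \<bullet> (hessian m x *v d)"
    and "m (x + d) \<le> M_alpha_plus m \<sigma> \<tau> x d"
    and "M_alpha_plus m \<sigma> (- \<tau>) x d \<le> m (x + d)"
proof -
  define a where "a = d \<bullet> (hessian m x *v d)"
  define b where "b = tensor3_cube T d + 6 * \<sigma> * (x \<bullet> d) * (d \<bullet> d)"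
  define c where "c = \<sigma> * norm d ^ 4"
  have c: "c \<ge> 0" using \<open>\<sigma> > 0\<close> by (simp add: c_def)
  have exp: "m (x + t *\<^sub>R d) = m x + (gradient m x \<bullet> d) * t + a / 2 * t\<^sup>2 + b / 6 * t ^ 3 + c / 4 * t ^ 4"
    for t
    unfolding a_def b_def c_def by (rule m3_expansion[OF sym m])
  have "2 * m (x + t *\<^sub>R d) \<le> m (x + (t + h) *\<^sub>R d) + m (x + (t - h) *\<^sub>R d)" for t h
    using strictly_convex_on_midpoint[OF conv, of "x + t *\<^sub>R d" "h *\<^sub>R d"]
    by (simp add: algebra_simps)
  then have curv: "0 \<le> a + b * t + 3 * c * t\<^sup>2" for t
    unfolding exp by (rule quartic_second_derivative_nonneg[OF _ c])
  show "0 \<le> d \<bullet> (hessian m x *v d)"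
    using curv[of 0] by (simp add: a_def)
  have "0 \<le> (a + b * \<tau> + 3 * c * \<tau>\<^sup>2) / (6 * \<tau>)" "0 \<le> (a + b * (- \<tau>) + 3 * c * (- \<tau>)\<^sup>2) / (6 * \<tau>)"
    using curv[of \<tau>] curv[of "- \<tau>"] \<open>\<tau> > 0\<close> by auto
  then have b: "- b / 6 \<le> a / (6 * \<tau>) + \<tau> * c / 2" "b / 6 \<le> a / (6 * \<tau>) + \<tau> * c / 2"
    using \<open>\<tau> > 0\<close> by (simp_all add: field_simps power2_eq_square)
  have M: "M_alpha_plus m \<sigma> \<theta> x d = m x + gradient m x \<bullet> d + a / 2 + a / (6 * \<theta>) + c / 4 + \<theta> * c / 2" for \<theta>
    by (simp add: M_alpha_plus_def a_def c_def algebra_simps add_divide_distrib)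
  \<comment> \<open>At \<open>t = 1\<close> the models differ from \<open>m\<close> only in
    replacing \<open>b / 6\<close> by plus or minus its bound.\<close>
  show "m (x + d) \<le> M_alpha_plus m \<sigma> \<tau> x d" "M_alpha_plus m \<sigma> (- \<tau>) x d \<le> m (x + d)"
    using exp[of 1] b M[of \<tau>] M[of "- \<tau>"] by simp_all
qed

text \<open>Constant and linear terms agree. Shortening scales the quadratic and quartic terms by
  \<open>\<mu>\<^sup>2\<close> and \<open>\<mu> ^ 4\<close>, interpolation only by
  \<open>\<mu>\<close>; cancelling one \<open>\<mu>\<close> leaves exactly the two assumed bounds,
  used with nonnegative \<open>a\<close> and \<open>c\<close>.\<close>

lemma M_alpha_plus_shortened_step:
  assumes "1/3 < \<tau>" "\<tau> < 1/2" "\<sigma> > 0" "0 < \<mu>"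
    and \<mu>: "\<mu> \<le> (3 * \<tau> - 1) / (3 * \<tau> + 1)" "\<mu> ^ 3 \<le> (1 - 2 * \<tau>) / (1 + 2 * \<tau>)"
    and psd: "0 \<le> d \<bullet> (hessian m x *v d)"
  shows "M_alpha_plus m \<sigma> \<tau> x (\<mu> *\<^sub>R d) \<le> (1 - \<mu>) * m x + \<mu> * M_alpha_plus m \<sigma> (- \<tau>) x d"
proof -
  define a where "a = d \<bullet> (hessian m x *v d)"
  define c where "c = \<sigma> * norm d ^ 4"
  have a: "a \<ge> 0" and c: "c \<ge> 0"
    using psd \<open>\<sigma> > 0\<close> by (simp_all add: a_def c_def)
  have "\<mu> * (3 * \<tau> + 1) \<le> 3 * \<tau> - 1"
    using \<mu>(1) assms(1) by (simp add: pos_le_divide_eq)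
  then have "\<mu> * (3 * \<tau> + 1) / (3 * \<tau>) \<le> (3 * \<tau> - 1) / (3 * \<tau>)"
    using assms(1) by (intro divide_right_mono) auto
  then have "\<mu> * (1 + 1 / (3 * \<tau>)) \<le> 1 - 1 / (3 * \<tau>)"
    using assms(1) by (simp add: add_divide_distrib diff_divide_distrib distrib_left)
  then have "\<mu> * a / 2 * (\<mu> * (1 + 1 / (3 * \<tau>))) \<le> \<mu> * a / 2 * (1 - 1 / (3 * \<tau>))"
    using a \<open>0 < \<mu>\<close> by (intro mult_left_mono) auto
  moreover have "\<mu> ^ 3 * (1 + 2 * \<tau>) \<le> 1 - 2 * \<tau>"
    using \<mu>(2) assms(1) by (simp add: field_simps)
  then have "\<mu> * c / 4 * (\<mu> ^ 3 * (1 + 2 * \<tau>)) \<le> \<mu> * c / 4 * (1 - 2 * \<tau>)"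
    using c \<open>0 < \<mu>\<close> by (intro mult_left_mono) auto
  moreover have "M_alpha_plus m \<sigma> \<tau> x (\<mu> *\<^sub>R d) = m x + \<mu> * (gradient m x \<bullet> d)
      + \<mu> * a / 2 * (\<mu> * (1 + 1 / (3 * \<tau>))) + \<mu> * c / 4 * (\<mu> ^ 3 * (1 + 2 * \<tau>))"
    unfolding M_alpha_plus_def a_def c_def norm_power4
    by (simp add: matrix_vector_mult_scaleR algebra_simps power2_eq_square power3_eq_cube)
  moreover have "\<mu> * M_alpha_plus m \<sigma> (- \<tau>) x d = \<mu> * m x + \<mu> * (gradient m x \<bullet> d)
      + \<mu> * a / 2 * (1 - 1 / (3 * \<tau>)) + \<mu> * c / 4 * (1 - 2 * \<tau>)"
  proof -
    have "M_alpha_plus m \<sigma> (- \<tau>) x d = m x + gradient m x \<bullet> d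
        + a / 2 * (1 - 1 / (3 * \<tau>)) + c / 4 * (1 - 2 * \<tau>)"
      by (simp add: M_alpha_plus_def a_def c_def mult_ac)
    then show ?thesis by (simp add: distrib_left)
  qed
  ultimately show ?thesis
    unfolding left_diff_distrib mult_1 by linarith
qed

theorem corollary2p1:
  fixes f0 \<sigma> \<tau> \<mu> m_star :: real
    and g :: "real ^ 'n"
    and H :: "real ^ 'n ^ 'n"
    and T :: "real ^ 'n ^ 'n ^ 'n"
    and m :: "real ^ 'n \<Rightarrow> real"
    and s s_plus :: "nat \<Rightarrow> real ^ 'n"
  assumes H_sym: "transpose H = H"
    and T_sym: "symmetric_tensor3 T"
    and sigma_pos: "\<sigma> > 0"
    and m_def: "m = m3 f0 g H T \<sigma>"
    and strictly_convex: "strictly_convex_on UNIV m"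
    and tau: "1/3 < \<tau>" "\<tau> < 1/2"
    and start: "s 0 = 0"
    and step: "\<And>i. s_plus i = (ARG_MIN (M_alpha_plus m \<sigma> \<tau> (s i)) d. True)"
    and update: "\<And>i. s (Suc i) = s i + s_plus i"
    and m_star: "m_star = (LEAST v. v \<in> range m)"
    and mu: "0 < \<mu>"
      "\<mu> \<le> min ((3 * \<tau> - 1) / (3 * \<tau> + 1)) (((1 - 2 * \<tau>) / (1 + 2 * \<tau>)) powr (1/3))"
  shows "\<forall>i. m (s i) - m_star \<le> (1 - \<mu>) ^ i * (m (s 0) - m_star)"
proof
  have tau_pos: "\<tau> > 0" using tau by simp
  have mu1: "\<mu> \<le> (3 * \<tau> - 1) / (3 * \<tau> + 1)" using mu(2) by simp
  have mu2: "\<mu> ^ 3 \<le> (1 - 2 * \<tau>) / (1 + 2 * \<tau>)"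
  proof -
    have "\<mu> ^ 3 \<le> (((1 - 2 * \<tau>) / (1 + 2 * \<tau>)) powr (1/3)) ^ 3"
      using mu by (intro power_mono) auto
    also have "\<dots> = (1 - 2 * \<tau>) / (1 + 2 * \<tau>)"
      using tau by (simp add: powr_powr flip: powr_realpow)
    finally show ?thesis .
  qed
  have "(3 * \<tau> - 1) / (3 * \<tau> + 1) \<le> 1"
    using tau by simp
  then have mu_le1: "\<mu> \<le> 1" using mu1 by linarith
  \<comment> \<open>An actual minimiser gives \<open>LEAST\<close> its meaning and serves as the
    target of the comparison step.\<close>
  obtain z where z: "\<And>y. m z \<le> m y"
    unfolding m_def using m3_attains_min[OF sigma_pos] by blast
  have m_star: "m_star = m z"
    unfolding m_star by (rule Least_equality) (use z in auto)
  note bounds = convex_m3_model_bounds[OF H_sym T_sym m_def sigma_pos tau_pos strictly_convex]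
  have contraction: "m (s (Suc i)) - m_star \<le> (1 - \<mu>) * (m (s i) - m_star)" for i
  proof -
    \<comment> \<open>Since \<open>s i + d = z\<close>, the lower model at \<open>d\<close> is at
      most \<open>m_star\<close>; the shortened step \<open>\<mu> *\<^sub>R d\<close> merely
      competes with the minimiser \<open>s_plus i\<close>.\<close>
    define d where "d = z - s i"
    have "m (s (Suc i)) \<le> M_alpha_plus m \<sigma> \<tau> (s i) (s_plus i)"
      unfolding update by (rule bounds(2))
    also have "\<dots> \<le> M_alpha_plus m \<sigma> \<tau> (s i) (\<mu> *\<^sub>R d)"
      unfolding step by (rule M_alpha_plus_arg_min[OF sigma_pos tau_pos])
    also have "\<dots> \<le> (1 - \<mu>) * m (s i) + \<mu> * M_alpha_plus m \<sigma> (- \<tau>) (s i) d"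
      by (rule M_alpha_plus_shortened_step[OF tau sigma_pos mu(1) mu1 mu2 bounds(1)])
    also have "\<dots> \<le> (1 - \<mu>) * m (s i) + \<mu> * m_star"
      using bounds(3)[of "s i" d] mu(1) by (simp add: d_def m_star)
    finally show ?thesis by (simp add: algebra_simps)
  qed
  fix i
  show "m (s i) - m_star \<le> (1 - \<mu>) ^ i * (m (s 0) - m_star)"
  proof (induction i)
    case (Suc i)
    \<comment> \<open>Here \<open>\<mu> \<le> 1\<close> keeps the multiplier nonnegative.\<close>
    have "(1 - \<mu>) * (m (s i) - m_star) \<le> (1 - \<mu>) * ((1 - \<mu>) ^ i * (m (s 0) - m_star))"
      using Suc mu_le1 by (intro mult_left_mono) auto
    then show ?case
      using contraction[of i] by (simp add: mult.assoc)
  qed simp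
qed

end
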